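(* Let $\alpha\in[0,1)$ and let $G$ be an optimal allocation path from $\mathbf{x}$ to $\mathbf{b}$. Then there exists an assignment map $S\in Map[\ell,k]$ such that $$\mathbf{E}_\alpha(S;\mathbf{x},\mathbf{b})=\mathbf{M}_\alpha(G).$$ Moreover, with $\mathbf{a}_i=\big(\sum_{j\in S^{-1}(i)}n_j\big)\delta_{x_i}$ and $\mathbf{b}_i=\sum_{j\in S^{-1}(i)}n_j\delta_{y_j}$, the path $G$ can be decomposed into the sum of $k$ pairwise disjoint transport paths $$G=\sum_{i=1}^kG_i\quad\text{with}\quad\mathbf{M}_\alpha(G)=\sum_{i=1}^k\mathbf{M}_\alpha(G_i),$$ where each $G_i\in Path(\mathbf{a}_i,\mathbf{b}_i)$ is an optimal transport path with $\mathbf{M}_\alpha(G_i)=d_\alpha(\mathbf{a}_i,\mathbf{b}_i)$.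
   Context: $X\subset\mathbb{R}^m$ is compact and convex, $\mathbf{x}=\{x_1,\dots,x_k\}\subset X$ is a set of $k$ points, $\mathbf{b}=\sum_{j=1}^\ell n_j\delta_{y_j}$ with $y_j\in X$, $n_j>0$, $\sum_jn_j=1$. Transport paths. For atomic measures $\mathbf{a},\mathbf{b}$ on $X$ of equal mass, a transport path from $\mathbf{a}$ to $\mathbf{b}$ is a weighted directed graph $G$ with a finite vertex set $V(G)$ containing all points used to write $\mathbf{a}$ and $\mathbf{b}$ (in $\sum_i m_i\delta_{x_i}$ zero masses are allowed), a finite set $E(G)$ of directed edges, each edge $e$ a line segment from $e^-$ to $e^+$, and weights $w:E(G)\to(0,\infty)$ such that for every $v\in V(G)$, $\sum_{e^-=v}w(e)=\sum_{e^+=v}w(e)+\mathbf{a}(\{v\})-\mathbf{b}(\{v\})$ (i.e. $\partial G=\mathbf{b}-\mathbf{a}$ when $G$ is viewed as a one-dimensional polyhedral chain; sums of paths are sums of chains). By standing convention transport paths contain no cycles. $Path(\mathbf{a},\mathbf{b})$ is the set of all of them; $\mathbf{M}_\alpha(G)=\sum_{e\in E(G)}w(e)^\alpha\,length(e)$, $d_\alpha(\mathbf{a},\mathbf{b})=\min\{\mathbf{M}_\alpha(G):G\in Path(\mathbf{a},\mathbf{b})\}$ ($0$ for zero measures), and minimizers are called optimal transport paths. An allocation path from $\mathbf{x}$ to $\mathbf{b}$ is an element of $Path(\mathbf{a},\mathbf{b})$ for some atomic probability measure $\mathbf{a}=\sum_{i=1}^km_i\delta_{x_i}$, $m_i\ge0$,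 supported on $\mathbf{x}$; the set of these is $Path[\mathbf{x},\mathbf{b}]$. It is optimal if it minimizes $\mathbf{M}_\alpha$ over $Path[\mathbf{x},\mathbf{b}]$. $Map[\ell,k]$ is the set of functions (assignment maps) $S:\{1,\dots,\ell\}\to\{1,\dots,k\}$, and $\mathbf{E}_\alpha(S;\mathbf{x},\mathbf{b})=\sum_{i=1}^kd_\alpha(\mathbf{a}_i,\mathbf{b}_i)$ with $\mathbf{a}_i,\mathbf{b}_i$ as given in the claim. *)

theory Defs
  imports "HOL-Analysis.Analysis"
begin

text \<open>
  An atomic measure \<open>\<Sum>i\<in>I. m i \<cdot> \<delta>(p i)\<close> together with the way it is written: the index set \<open>I\<close>
  is finite in all uses, the masses \<open>m i\<close> may be zero and the points \<open>p i\<close> may repeat.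
\<close>
datatype 'a atomic = Atomic (atom_index: "nat set") (atom_weight: "nat \<Rightarrow> real") (atom_point: "nat \<Rightarrow> 'a")

definition atom_points :: "'a atomic \<Rightarrow> 'a set" where
  "atom_points a = atom_point a ` atom_index a"

text \<open>\<open>\<delta>\<^sub>p(A)\<close> is \<open>indicator A p\<close>.\<close>
definition atom_mass :: "'a atomic \<Rightarrow> 'a set \<Rightarrow> real" where
  "atom_mass a A = (\<Sum>i\<in>atom_index a. atom_weight a i * indicator A (atom_point a i))"

text \<open>
  The edge \<open>(u, v)\<close> is the oriented segment from \<open>u\<close> to \<open>v\<close>; the values of \<open>weight\<close> outside
  \<open>edges\<close> are irrelevant. Parallel edges are not representable; they would form a cycle.
\<close>
record 'a wgraph =
  verts :: "'a set"
  edges :: "('a \<times> 'a) set"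
  weight :: "'a \<times> 'a \<Rightarrow> real"

text \<open>
  Cycles are taken irrespective of the orientation of the edges. Length one is a loop (a
  degenerate segment), length two a pair of antiparallel edges.
\<close>
definition has_cycle :: "('a \<times> 'a) set \<Rightarrow> bool" where
  "has_cycle E \<longleftrightarrow> (\<exists>vs es. vs \<noteq> [] \<and> length es = length vs \<and> distinct vs \<and> distinct es \<and> set es \<subseteq> E \<and>
     (\<forall>i<length vs. {fst (es ! i), snd (es ! i)} = {vs ! i, vs ! (Suc i mod length vs)}))"

definition transport_paths :: "'a::euclidean_space set \<Rightarrow> 'a atomic \<Rightarrow> 'a atomic \<Rightarrow> 'a wgraph set" where
  "transport_paths X a b = {G.
     finite (verts G) \<and> verts G \<subseteq> X \<and> atom_points a \<union> atom_points b \<subseteq> verts G \<and>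
     edges G \<subseteq> verts G \<times> verts G \<and> (\<forall>e\<in>edges G. 0 < weight G e) \<and>
     (\<forall>v\<in>verts G. (\<Sum>e\<in>{e\<in>edges G. fst e = v}. weight G e) =
        (\<Sum>e\<in>{e\<in>edges G. snd e = v}. weight G e) + atom_mass a {v} - atom_mass b {v}) \<and>
     \<not> has_cycle (edges G)}"

definition M_cost :: "real \<Rightarrow> 'a::euclidean_space wgraph \<Rightarrow> real" where
  "M_cost \<alpha> G = (\<Sum>e\<in>edges G. weight G e powr \<alpha> * dist (fst e) (snd e))"

definition optimal_transport_path ::
    "'a::euclidean_space set \<Rightarrow> real \<Rightarrow> 'a atomic \<Rightarrow> 'a atomic \<Rightarrow> 'a wgraph \<Rightarrow> bool" where
  "optimal_transport_path X \<alpha> a b G \<longleftrightarrow> is_arg_min (M_cost \<alpha>) (\<lambda>H. H \<in> transport_paths X a b) G"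

text \<open>
  The infimum is the minimum whenever an optimal transport path exists. For zero measures it is 0,
  attained by a graph without edges.
\<close>
definition d_cost :: "'a::euclidean_space set \<Rightarrow> real \<Rightarrow> 'a atomic \<Rightarrow> 'a atomic \<Rightarrow> real" where
  "d_cost X \<alpha> a b = (INF G\<in>transport_paths X a b. M_cost \<alpha> G)"

definition allocation_paths ::
    "'a::euclidean_space set \<Rightarrow> nat \<Rightarrow> (nat \<Rightarrow> 'a) \<Rightarrow> 'a atomic \<Rightarrow> 'a wgraph set" where
  "allocation_paths X k x b = {G. \<exists>m. (\<forall>i\<in>{1..k}. 0 \<le> m i) \<and> (\<Sum>i=1..k. m i) = 1 \<and>
     G \<in> transport_paths X (Atomic {1..k} m x) b}"

definition optimal_allocation_path ::
    "'a::euclidean_space set \<Rightarrow> real \<Rightarrow> nat \<Rightarrow> (nat \<Rightarrow> 'a) \<Rightarrow> 'a atomic \<Rightarrow> 'a wgraph \<Rightarrow> bool" where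
  "optimal_allocation_path X \<alpha> k x b G \<longleftrightarrow>
     is_arg_min (M_cost \<alpha>) (\<lambda>H. H \<in> allocation_paths X k x b) G"

definition assignment_maps :: "nat \<Rightarrow> nat \<Rightarrow> (nat \<Rightarrow> nat) set" where
  "assignment_maps l k = {1..l} \<rightarrow>\<^sub>E {1..k}"

definition fibre :: "nat \<Rightarrow> (nat \<Rightarrow> nat) \<Rightarrow> nat \<Rightarrow> nat set" where
  "fibre l S i = {j\<in>{1..l}. S j = i}"

definition part_source :: "nat \<Rightarrow> (nat \<Rightarrow> real) \<Rightarrow> (nat \<Rightarrow> 'a) \<Rightarrow> (nat \<Rightarrow> nat) \<Rightarrow> nat \<Rightarrow> 'a atomic" where
  "part_source l n x S i = Atomic {i} (\<lambda>_. \<Sum>j\<in>fibre l S i. n j) x"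

definition part_target :: "nat \<Rightarrow> (nat \<Rightarrow> real) \<Rightarrow> (nat \<Rightarrow> 'a) \<Rightarrow> (nat \<Rightarrow> nat) \<Rightarrow> nat \<Rightarrow> 'a atomic" where
  "part_target l n y S i = Atomic (fibre l S i) n y"

definition E_cost :: "'a::euclidean_space set \<Rightarrow> real \<Rightarrow> nat \<Rightarrow> (nat \<Rightarrow> 'a) \<Rightarrow>
    nat \<Rightarrow> (nat \<Rightarrow> real) \<Rightarrow> (nat \<Rightarrow> 'a) \<Rightarrow> (nat \<Rightarrow> nat) \<Rightarrow> real" where
  "E_cost X \<alpha> k x l n y S = (\<Sum>i=1..k. d_cost X \<alpha> (part_source l n x S i) (part_target l n y S i))"

text \<open>
  The one-dimensional polyhedral chain (current) carried by \<open>G\<close>, acting on continuous 1-forms,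
  i.e. continuous vector fields. Equality of chains, hence \<open>chain_sum\<close>, is equality on all of
  these, so it is insensitive to subdivision of edges and to isolated vertices.
\<close>
definition chain_integral :: "'a::euclidean_space wgraph \<Rightarrow> ('a \<Rightarrow> 'a) \<Rightarrow> real" where
  "chain_integral G F = (\<Sum>e\<in>edges G. weight G e *
     integral {0..1} (\<lambda>t. F (linepath (fst e) (snd e) t) \<bullet> (snd e - fst e)))"

definition chain_sum :: "'a::euclidean_space wgraph \<Rightarrow> nat set \<Rightarrow> (nat \<Rightarrow> 'a wgraph) \<Rightarrow> bool" where
  "chain_sum G I Gs \<longleftrightarrow>
     (\<forall>F. continuous_on UNIV F \<longrightarrow> chain_integral G F = (\<Sum>i\<in>I. chain_integral (Gs i) F))"

definition graph_support :: "'a::euclidean_space wgraph \<Rightarrow> 'a set" where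
  "graph_support G = verts G \<union> (\<Union>e\<in>edges G. closed_segment (fst e) (snd e))"

end

theory Submission
  imports Defs
begin

text \<open>
  The cost is concave in the edge weights, and strictly so where a weight drops to zero. Hence, if a
  unit flow \<open>s\<close> can be added to an optimal flow with small coefficients of both signs, pushing
  along \<open>s\<close> or \<open>-s\<close> until an edge disappears or by a small amount lowers the cost. No edge enters
  a point \<open>x\<^sub>i\<close>, even one of zero mass, since it would be cheaper to start that flow at \<open>x\<^sub>i\<close>.
  So two of these points in one component of \<open>G\<close> would both have positive mass, and moving mass from
  one to the other along a path of \<open>G\<close> would be a perturbation as above.
  Subdividing edges at geometric crossings keeps the flow optimal, so even the supports of the components are disjoint. The component of \<open>x\<^sub>i\<close> is \<open>G\<^sub>i\<close>, and
  \<open>S j\<close> is the index of the component of \<open>y\<^sub>j\<close>. Each \<open>G\<^sub>i\<close> is optimal because a cheaper replacement,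
  added to the other components, would make \<open>G\<close> cheaper by subadditivity of the cost.
\<close>

section \<open>Concavity of the cost\<close>

text \<open>A concave power lies below its tangent; this is the weighted AM-GM inequality divided by
  \<open>z powr (1 - a)\<close>. At \<open>x = 0\<close> the left side is 0, also for
  \<open>a = 0\<close> by the convention \<open>0 powr 0 = 0\<close>, while the right side is
  \<open>(1 - a) * z powr a > 0\<close>.\<close>

lemma powr_le_tangent:
  fixes x z a :: real
  assumes "0 \<le> a" "a < 1" "0 < z" "0 \<le> x"
  shows "x powr a \<le> z powr a + a * z powr (a - 1) * (x - z)"
    and "x = 0 \<Longrightarrow> x powr a < z powr a + a * z powr (a - 1) * (x - z)"
proof -
  have z: "z powr (a - 1) * z = z powr a"
    using assms by (simp add: powr_diff)
  have rhs: "z powr a + a * z powr (a - 1) * (x - z) = a * x * z powr (a - 1) + (1 - a) * z powr a"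
    unfolding z [symmetric] by (simp add: algebra_simps)
  show strict: "x powr a < z powr a + a * z powr (a - 1) * (x - z)" if "x = 0"
    unfolding rhs using that assms by simp
  show "x powr a \<le> z powr a + a * z powr (a - 1) * (x - z)"
  proof (cases "x = 0")
    case False
    then have "x powr a * z powr (1 - a) \<le> a * x + (1 - a) * z"
      using assms by (intro Youngs_inequality_0) auto
    then have "x powr a * z powr (1 - a) * z powr (a - 1) \<le> (a * x + (1 - a) * z) * z powr (a - 1)"
      by (rule mult_right_mono) simp
    moreover have "x powr a * z powr (1 - a) * z powr (a - 1) = x powr a"
      using assms by (simp add: mult.assoc flip: powr_add)
    moreover have "(a * x + (1 - a) * z) * z powr (a - 1) = a * x * z powr (a - 1) + (1 - a) * z powr a"
      unfolding z [symmetric] by (simp add: algebra_simps)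
    ultimately show ?thesis
      unfolding rhs by simp
  qed (use strict in simp)
qed

text \<open>Since \<open>a - 1\<close> is not positive, \<open>z * (x + y) powr (a - 1)\<close> is
  at most \<open>z powr a\<close> for \<open>z = x\<close> and for \<open>z = y\<close>; the two
  left sides add up to \<open>(x + y) powr a\<close>.\<close>

lemma powr_add_le:
  fixes x y a :: real
  assumes "0 \<le> x" "0 \<le> y" "a \<le> 1"
  shows "(x + y) powr a \<le> x powr a + y powr a"
proof (cases "x = 0 \<or> y = 0")
  case False
  then have pos: "0 < x" "0 < y" using assms by auto
  have step: "z * (x + y) powr (a - 1) \<le> z powr a" if "0 < z" "z \<le> x + y" for z
  proof -
    have "z * (x + y) powr (a - 1) \<le> z * z powr (a - 1)"
      using that assms by (intro mult_left_mono powr_mono2') auto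
    then show ?thesis using that by (simp add: powr_diff)
  qed
  have "(x + y) powr a = x * (x + y) powr (a - 1) + y * (x + y) powr (a - 1)"
    using pos by (simp add: powr_diff add_divide_distrib [symmetric] flip: distrib_right)
  then show ?thesis
    using step [of x] step [of y] pos by simp
qed auto

section \<open>Cost of a weighted edge set and its first-order change\<close>

definition flow_cost :: "real \<Rightarrow> ('a::euclidean_space \<times> 'a) set \<Rightarrow> ('a \<times> 'a \<Rightarrow> real) \<Rightarrow> real" where
  "flow_cost \<alpha> E w = (\<Sum>e\<in>E. w e powr \<alpha> * dist (fst e) (snd e))"

text \<open>The derivative of \<open>flow_cost\<close> at a positive weight \<open>w\<close> in the
  direction \<open>s\<close>.\<close>

definition cost_slope ::
    "real \<Rightarrow> ('a::euclidean_space \<times> 'a) set \<Rightarrow> ('a \<times> 'a \<Rightarrow> real) \<Rightarrow> ('a \<times> 'a \<Rightarrow> real) \<Rightarrow> real" where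
  "cost_slope \<alpha> E w s = (\<Sum>e\<in>E. \<alpha> * w e powr (\<alpha> - 1) * s e * dist (fst e) (snd e))"

lemma M_cost_eq_flow_cost: "M_cost \<alpha> G = flow_cost \<alpha> (edges G) (weight G)"
  by (simp add: M_cost_def flow_cost_def)

lemma flow_cost_cong:
  assumes "\<And>e. e \<in> E \<Longrightarrow> w e = w' e"
  shows "flow_cost \<alpha> E w = flow_cost \<alpha> E w'"
  unfolding flow_cost_def using assms by (intro sum.cong) auto

lemma flow_cost_mono_neutral:
  assumes "finite E" "E' \<subseteq> E" "\<And>e. e \<in> E - E' \<Longrightarrow> w e = 0"
  shows "flow_cost \<alpha> E' w = flow_cost \<alpha> E w"
  unfolding flow_cost_def using assms by (intro sum.mono_neutral_left) auto

lemma flow_cost_union_disjoint: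
  assumes "finite E" "finite F" "E \<inter> F = {}"
  shows "flow_cost \<alpha> (E \<union> F) w = flow_cost \<alpha> E w + flow_cost \<alpha> F w"
  unfolding flow_cost_def using assms by (rule sum.union_disjoint)

lemma flow_cost_add_le:
  assumes "\<And>e. e \<in> E \<Longrightarrow> 0 \<le> w e" "\<And>e. e \<in> E \<Longrightarrow> 0 \<le> w' e" "\<alpha> \<le> 1"
  shows "flow_cost \<alpha> E (\<lambda>e. w e + w' e) \<le> flow_cost \<alpha> E w + flow_cost \<alpha> E w'"
  unfolding flow_cost_def sum.distrib [symmetric] distrib_right [symmetric]
  using assms by (intro sum_mono mult_right_mono powr_add_le) auto

lemma flow_cost_perturb_term:
  fixes e :: "'a::euclidean_space \<times> 'a"
  assumes "0 \<le> \<alpha>" "\<alpha> < 1" "0 < w e" "0 \<le> w e + t * s e"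
  shows "(w e + t * s e) powr \<alpha> * dist (fst e) (snd e) \<le>
      w e powr \<alpha> * dist (fst e) (snd e) + t * (\<alpha> * w e powr (\<alpha> - 1) * s e * dist (fst e) (snd e))"
    and "w e + t * s e = 0 \<Longrightarrow> fst e \<noteq> snd e \<Longrightarrow>
      (w e + t * s e) powr \<alpha> * dist (fst e) (snd e) <
      w e powr \<alpha> * dist (fst e) (snd e) + t * (\<alpha> * w e powr (\<alpha> - 1) * s e * dist (fst e) (snd e))"
proof -
  have eq: "w e powr \<alpha> * d + t * (\<alpha> * w e powr (\<alpha> - 1) * s e * d) =
      (w e powr \<alpha> + \<alpha> * w e powr (\<alpha> - 1) * ((w e + t * s e) - w e)) * d" for d
    by (simp add: algebra_simps)
  show "(w e + t * s e) powr \<alpha> * dist (fst e) (snd e) \<le>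
      w e powr \<alpha> * dist (fst e) (snd e) + t * (\<alpha> * w e powr (\<alpha> - 1) * s e * dist (fst e) (snd e))"
    unfolding eq using powr_le_tangent(1) [OF assms] by (rule mult_right_mono) simp
  show "(w e + t * s e) powr \<alpha> * dist (fst e) (snd e) <
      w e powr \<alpha> * dist (fst e) (snd e) + t * (\<alpha> * w e powr (\<alpha> - 1) * s e * dist (fst e) (snd e))"
    if "w e + t * s e = 0" "fst e \<noteq> snd e"
    unfolding eq using powr_le_tangent(2) [OF assms that(1)] that(2)
    by (intro mult_strict_right_mono) auto
qed

lemma flow_cost_perturb_le:
  assumes "0 \<le> \<alpha>" "\<alpha> < 1" "\<And>e. e \<in> E \<Longrightarrow> 0 < w e" "\<And>e. e \<in> E \<Longrightarrow> 0 \<le> w e + t * s e"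
  shows "flow_cost \<alpha> E (\<lambda>e. w e + t * s e) \<le> flow_cost \<alpha> E w + t * cost_slope \<alpha> E w s"
  unfolding flow_cost_def cost_slope_def sum_distrib_left sum.distrib [symmetric]
  using assms by (intro sum_mono flow_cost_perturb_term(1))

lemma flow_cost_perturb_less:
  assumes "0 \<le> \<alpha>" "\<alpha> < 1" "\<And>e. e \<in> E \<Longrightarrow> 0 < w e" "\<And>e. e \<in> E \<Longrightarrow> 0 \<le> w e + t * s e"
    and "finite E" "e \<in> E" "w e + t * s e = 0" "fst e \<noteq> snd e"
  shows "flow_cost \<alpha> E (\<lambda>e. w e + t * s e) < flow_cost \<alpha> E w + t * cost_slope \<alpha> E w s"
  unfolding flow_cost_def cost_slope_def sum_distrib_left sum.distrib [symmetric]
  using assms by (intro sum_strict_mono_ex1 ballI bexI [of _ e] flow_cost_perturb_term) auto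

lemma cost_slope_nonpos:
  assumes "0 \<le> \<alpha>" "\<And>e. e \<in> E \<Longrightarrow> s e \<le> 0"
  shows "cost_slope \<alpha> E w s \<le> 0"
  unfolding cost_slope_def using assms
  by (intro sum_nonpos mult_nonpos_nonneg mult_nonneg_nonpos) auto

lemma cost_slope_uminus: "cost_slope \<alpha> E w (\<lambda>e. - s e) = - cost_slope \<alpha> E w s"
  by (simp add: cost_slope_def sum_negf)

text \<open>The ratio test of the simplex method: \<open>t\<close> is the least
  \<open>w e / - s e\<close> over the edges where \<open>s\<close> is negative, so the minimizing
  edge is among the first to vanish.\<close>

lemma obtain_vanishing_step:
  fixes w s :: "'e \<Rightarrow> real"
  assumes "finite E" "\<And>e. e \<in> E \<Longrightarrow> 0 < w e" "e0 \<in> E" "s e0 < 0"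
  obtains t e where "0 < t" "\<And>e. e \<in> E \<Longrightarrow> 0 \<le> w e + t * s e" "e \<in> E" "s e < 0" "w e + t * s e = 0"
proof -
  define N where "N = {e \<in> E. s e < 0}"
  define q where "q e = w e / - s e" for e
  have N: "finite N" "N \<noteq> {}" using assms by (auto simp: N_def)
  obtain e where e: "e \<in> N" "\<And>e'. e' \<in> N \<Longrightarrow> q e \<le> q e'"
    using arg_min_if_finite [OF N, of q] by (metis linorder_not_less)
  have qpos: "0 < q e"
    using e(1) assms by (simp add: N_def q_def divide_pos_neg)
  show thesis
  proof
    show "0 < q e" by fact
    show "e \<in> E" "s e < 0" using e(1) by (auto simp: N_def)
    then show "w e + q e * s e = 0" by (simp add: q_def)
    show "0 \<le> w e' + q e * s e'" if "e' \<in> E" for e'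
    proof (cases "s e' < 0")
      case True
      then have "q e \<le> w e' / - s e'" using e(2) that by (auto simp: N_def q_def)
      then have "q e * - s e' \<le> w e'" using True by (subst (asm) pos_le_divide_eq) auto
      then show ?thesis by simp
    next
      case False
      then show ?thesis using assms(2) [OF that] qpos by simp
    qed
  qed
qed

text \<open>Small only means that no weight turns negative; the tangent bound holds for every such
  step.\<close>

lemma obtain_small_step:
  fixes w s :: "'e \<Rightarrow> real"
  assumes "finite E" "\<And>e. e \<in> E \<Longrightarrow> 0 < w e"
  obtains t where "0 < t" "\<And>e. e \<in> E \<Longrightarrow> 0 \<le> w e + t * s e"
proof (cases "\<exists>e\<in>E. s e < 0")
  case True
  then obtain e0 where "e0 \<in> E" "s e0 < 0" by blast
  then show thesis using obtain_vanishing_step [where w = w and s = s, OF assms] that by metis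
next
  case False
  then show thesis using that [of 1] assms(2) by (simp add: add_nonneg_nonneg less_imp_le not_less)
qed

section \<open>Net outflow\<close>

text \<open>Minus the coefficient at \<open>v\<close> of the boundary of the 1-chain
  \<open>w\<close>. It is defined at every point, without reference to a vertex set, and a loop
  contributes nothing.\<close>

definition net :: "('a \<times> 'a) set \<Rightarrow> ('a \<times> 'a \<Rightarrow> real) \<Rightarrow> 'a \<Rightarrow> real" where
  "net E w v = (\<Sum>e\<in>E. w e * (of_bool (fst e = v) - of_bool (snd e = v)))"

lemma net_cong: "(\<And>e. e \<in> E \<Longrightarrow> w e = w' e) \<Longrightarrow> net E w v = net E w' v"
  unfolding net_def by (intro sum.cong) auto

lemma net_add: "net E (\<lambda>e. w e + w' e) v = net E w v + net E w' v"
  by (simp add: net_def distrib_right sum.distrib)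

lemma net_scale: "net E (\<lambda>e. t * w e) v = t * net E w v"
  by (simp add: net_def sum_distrib_left algebra_simps)

lemma net_perturb: "net E (\<lambda>e. w e + t * s e) v = net E w v + t * net E s v"
  by (simp add: net_add net_scale)

lemma net_mono_neutral:
  assumes "finite E" "E' \<subseteq> E" "\<And>e. e \<in> E - E' \<Longrightarrow> w e = 0"
  shows "net E' w v = net E w v"
  unfolding net_def using assms by (intro sum.mono_neutral_left) auto

lemma net_union_disjoint:
  assumes "finite E" "finite F" "E \<inter> F = {}"
  shows "net (E \<union> F) w v = net E w v + net F w v"
  unfolding net_def using assms by (rule sum.union_disjoint)

lemma net_of_bool:
  assumes "finite E" "e \<in> E"
  shows "net E (\<lambda>e'. of_bool (e' = e)) v = of_bool (fst e = v) - of_bool (snd e = v)"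
proof -
  have "net E (\<lambda>e'. of_bool (e' = e)) v =
      (\<Sum>e'\<in>E. if e = e' then of_bool (fst e = v) - of_bool (snd e = v) else 0)"
    unfolding net_def by (intro sum.cong) auto
  then show ?thesis using assms by simp
qed

lemma net_eq_out_minus_in:
  assumes "finite E"
  shows "net E w v = (\<Sum>e\<in>{e\<in>E. fst e = v}. w e) - (\<Sum>e\<in>{e\<in>E. snd e = v}. w e)"
proof -
  have "net E w v = (\<Sum>e\<in>E. w e * of_bool (fst e = v)) - (\<Sum>e\<in>E. w e * of_bool (snd e = v))"
    by (simp add: net_def right_diff_distrib sum_subtractf)
  moreover have "(\<Sum>e\<in>E. w e * of_bool (P e)) = (\<Sum>e\<in>{e\<in>E. P e}. w e)" for P
    using assms by (simp add: sum.inter_filter if_distrib of_bool_def cong: if_cong)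
  ultimately show ?thesis by simp
qed

text \<open>Each edge counts once at its tail and once, with the opposite sign, at its head.\<close>

lemma sum_net_eq_0:
  assumes "finite V" "E \<subseteq> V \<times> V"
  shows "(\<Sum>v\<in>V. net E w v) = 0"
proof -
  have "(\<Sum>v\<in>V. net E w v) =
      (\<Sum>e\<in>E. \<Sum>v\<in>V. w e * (of_bool (fst e = v) - of_bool (snd e = v)))"
    unfolding net_def by (rule sum.swap)
  also have "\<dots> = (\<Sum>e\<in>E. w e * ((\<Sum>v\<in>V. of_bool (fst e = v)) - (\<Sum>v\<in>V. of_bool (snd e = v))))"
    by (simp only: sum_distrib_left [symmetric] sum_subtractf)
  also have "\<dots> = 0"
  proof (intro sum.neutral ballI)
    fix e assume "e \<in> E"
    then have "fst e \<in> V" "snd e \<in> V" using assms(2) by auto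
    then show "w e * ((\<Sum>v\<in>V. of_bool (fst e = v)) - (\<Sum>v\<in>V. of_bool (snd e = v))) = 0"
      using assms(1) by (simp add: of_bool_def)
  qed
  finally show ?thesis .
qed

lemma net_nonneg_root:
  assumes "\<And>e. e \<in> E \<Longrightarrow> 0 \<le> w e" "\<And>u. (u, v) \<notin> E"
  shows "0 \<le> net E w v"
  unfolding net_def
proof (intro sum_nonneg mult_nonneg_nonneg)
  fix e assume "e \<in> E"
  then show "0 \<le> w e" "0 \<le> of_bool (fst e = v) - (of_bool (snd e = v) :: real)"
    using assms by (auto simp: of_bool_def) (metis prod.collapse)+
qed

lemma net_pos_root:
  assumes "finite E" "\<And>e. e \<in> E \<Longrightarrow> 0 < w e" "\<And>u. (u, v) \<notin> E" "(v, u) \<in> E"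
  shows "0 < net E w v"
  unfolding net_def
proof (rule sum_pos2 [of _ "(v, u)"])
  show "0 < w (v, u) * (of_bool (fst (v, u) = v) - of_bool (snd (v, u) = v))"
    using assms by (auto simp: of_bool_def)
  fix e assume "e \<in> E"
  then show "0 \<le> w e * (of_bool (fst e = v) - of_bool (snd e = v))"
    using assms by (intro mult_nonneg_nonneg) (auto simp: of_bool_def less_imp_le, metis prod.collapse)
qed (use assms in auto)

text \<open>Without incoming edges the net outflow is a sum of values of \<open>s\<close>, so one of
  them is positive. This supplies an edge whose weight decreases when \<open>-s\<close> is
  added.\<close>

lemma net_pos_imp_pos_edge:
  assumes "0 < net E s v" "\<And>u. (u, v) \<notin> E"
  obtains e where "e \<in> E" "0 < s e"
proof (rule ccontr)
  assume "\<not> thesis"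
  then have "\<And>e. e \<in> E \<Longrightarrow> 0 \<le> - s e" using that by (meson neg_0_le_iff_le not_less)
  then have "0 \<le> net E (\<lambda>e. - s e) v" using assms(2) by (intro net_nonneg_root) auto
  then show False using assms(1) net_scale [of E "-1" s v] by simp
qed

section \<open>Connectedness irrespective of orientation, and unit flows along paths\<close>

abbreviation linked :: "('a \<times> 'a) set \<Rightarrow> ('a \<times> 'a) set" where
  "linked E \<equiv> (E \<union> E\<inverse>)\<^sup>*"

lemma linked_sym: "(u, v) \<in> linked E \<Longrightarrow> (v, u) \<in> linked E"
  by (metis converse_Un converse_converse rtrancl_converseI sup_commute)

lemma linked_trans: "(u, v) \<in> linked E \<Longrightarrow> (v, z) \<in> linked E \<Longrightarrow> (u, z) \<in> linked E"
  by (rule rtrancl_trans)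

lemma linked_edge: "(u, v) \<in> E \<Longrightarrow> (u, v) \<in> linked E"
  by blast

lemma rtrancl_subset_linked: "(u, v) \<in> E\<^sup>* \<Longrightarrow> (u, v) \<in> linked E"
  by (meson in_rtrancl_UnI)

text \<open>Along the path, 1 is added on each edge traversed forwards and subtracted on each edge
  traversed backwards.\<close>

lemma obtain_unit_flow:
  assumes "finite E" "(u, v) \<in> linked E"
  obtains s :: "'a \<times> 'a \<Rightarrow> real" where "\<And>e. e \<notin> E \<Longrightarrow> s e = 0"
    "\<And>z. net E s z = of_bool (u = z) - of_bool (v = z)"
  using assms(2)
proof (induction arbitrary: thesis rule: rtrancl_induct)
  case base
  show ?case by (rule base [of "\<lambda>_. 0"]) (auto simp: net_def)
next
  case (step v z)
  obtain s where s: "\<And>e. e \<notin> E \<Longrightarrow> s e = 0"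
    "\<And>z. net E s z = of_bool (u = z) - of_bool (v = z)"
    using step.IH by metis
  show ?case
  proof (cases "(v, z) \<in> E")
    case True
    then show ?thesis
      using s assms(1)
      by (intro step.prems [of "\<lambda>e. s e + of_bool (e = (v, z))"]) (auto simp: net_add net_of_bool)
  next
    case False
    then have "(z, v) \<in> E" using step.hyps by auto
    then show ?thesis
      using s assms(1)
      by (intro step.prems [of "\<lambda>e. s e + (-1) * of_bool (e = (z, v))"])
        (auto simp only: net_perturb net_of_bool, auto)
  qed
qed

text \<open>A directed path is traversed forwards only, so nothing is ever subtracted.\<close>

lemma obtain_directed_unit_flow:
  assumes "finite E" "(u, v) \<in> E\<^sup>*"
  obtains s :: "'a \<times> 'a \<Rightarrow> real" where "\<And>e. 0 \<le> s e"
    "\<And>z. net E s z = of_bool (u = z) - of_bool (v = z)"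
  using assms(2)
proof (induction arbitrary: thesis rule: rtrancl_induct)
  case base
  show ?case by (rule base [of "\<lambda>_. 0"]) (auto simp: net_def)
next
  case (step v z)
  obtain s where s: "\<And>e. 0 \<le> s e" "\<And>z. net E s z = of_bool (u = z) - of_bool (v = z)"
    using step.IH by metis
  show ?case
    using s assms(1) step.hyps
    by (intro step.prems [of "\<lambda>e. s e + of_bool (e = (v, z))"]) (auto simp: net_add net_of_bool)
qed

section \<open>Elimination of cycles\<close>

lemma has_cycle_mono: "has_cycle E \<Longrightarrow> E \<subseteq> E' \<Longrightarrow> has_cycle E'"
  unfolding has_cycle_def by (meson subset_trans)

text \<open>The first edge is taken out of the cycle; the others still connect its ends the long way
  round. For a loop the ends coincide.\<close>

lemma has_cycle_imp_linked_without_edge: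
  assumes "has_cycle E"
  obtains e where "e \<in> E" "(fst e, snd e) \<in> linked (E - {e})"
proof -
  obtain vs es where vs: "vs \<noteq> []" and len: "length es = length vs"
    and "distinct es" "set es \<subseteq> E"
    and ends: "\<And>i. i < length vs \<Longrightarrow>
      {fst (es ! i), snd (es ! i)} = {vs ! i, vs ! (Suc i mod length vs)}"
    using assms unfolding has_cycle_def by blast
  define e where "e = es ! 0"
  \<comment> \<open>Reading the vertices modulo the length gives \<open>c (length vs) = c 0\<close>,
    which closes the cycle.\<close>
  define c where "c i = vs ! (i mod length vs)" for i
  have mem: "es ! i \<in> E" if "i < length vs" for i
    using that len \<open>set es \<subseteq> E\<close> by (metis nth_mem subsetD)
  have consec: "(c i, c (Suc i)) \<in> linked (E - {e})" if "1 \<le> i" "i < length vs" for i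
  proof -
    \<comment> \<open>Distinctness of \<open>es\<close> keeps the later edges of the cycle different
      from \<open>e\<close>.\<close>
    have "es ! i \<in> E - {e}"
      using that len mem [of i] nth_eq_iff_index_eq [OF \<open>distinct es\<close>, of i 0] vs
      by (simp add: e_def del: length_greater_0_conv)
    then have "(fst (es ! i), snd (es ! i)) \<in> linked (E - {e})"
      by (intro linked_edge) simp
    moreover have "{fst (es ! i), snd (es ! i)} = {c i, c (Suc i)}"
      using ends [of i] that by (simp add: c_def)
    ultimately show ?thesis
      using linked_sym by (metis doubleton_eq_iff)
  qed
  have path: "(c 1, c i) \<in> linked (E - {e})" if "1 \<le> i" "i \<le> length vs" for i
    using that
  proof (induction rule: dec_induct)
    case base
    show ?case by simp
  next
    case (step i)
    then have "(c 1, c i) \<in> linked (E - {e})" "(c i, c (Suc i)) \<in> linked (E - {e})"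
      using consec [of i] by auto
    then show ?case by (rule linked_trans)
  qed
  have "(c 1, c 0) \<in> linked (E - {e})"
    using path [of "length vs"] vs by (simp add: c_def Suc_leI)
  moreover have "{fst e, snd e} = {c 0, c 1}"
    using ends [of 0] vs by (simp add: c_def e_def)
  ultimately have "(fst e, snd e) \<in> linked (E - {e})"
    using linked_sym by (metis doubleton_eq_iff)
  moreover have "e \<in> E" using mem [of 0] vs by (simp add: e_def)
  ultimately show thesis using that by blast
qed

text \<open>One unit along an edge \<open>e\<close> of the cycle, returned through the other edges.
  The return flow vanishes on \<open>e\<close>, so \<open>e\<close> carries exactly 1.\<close>

lemma obtain_circulation:
  assumes "finite E" "has_cycle E"
  obtains s e where "e \<in> E" "0 < s e" "\<And>v. net E s v = 0"
proof -
  obtain e where e: "e \<in> E" "(fst e, snd e) \<in> linked (E - {e})"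
    using has_cycle_imp_linked_without_edge [OF assms(2)] .
  obtain s where s: "\<And>e'. e' \<notin> E - {e} \<Longrightarrow> s e' = 0"
    "\<And>z. net (E - {e}) s z = of_bool (fst e = z) - of_bool (snd e = z)"
    using obtain_unit_flow [OF _ e(2)] assms(1) by (metis finite_Diff)
  have "net E s z = of_bool (fst e = z) - of_bool (snd e = z)" for z
    using net_mono_neutral [of E "E - {e}" s z] s assms(1) by auto
  then have "net E (\<lambda>e'. of_bool (e' = e) + (-1) * s e') z = 0" for z
    using e(1) assms(1) by (simp only: net_perturb net_of_bool) simp
  moreover have "s e = 0" using s(1) by simp
  ultimately show thesis using e(1) by (intro that [of e "\<lambda>e'. of_bool (e' = e) + (-1) * s e'"]) auto
qed

text \<open>As long as there is a cycle, weight is pushed along a circulation of nonpositive slope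
  until an edge vanishes; by concavity the cost does not rise. The edge set shrinks each time, so
  this ends with edges admissible in a transport path.\<close>

lemma obtain_acyclic_flow:
  assumes "0 \<le> \<alpha>" "\<alpha> < 1" "finite E" "\<And>e. e \<in> E \<Longrightarrow> 0 \<le> w e"
  obtains E' w' where "E' \<subseteq> E" "\<And>e. e \<in> E' \<Longrightarrow> 0 < w' e" "\<not> has_cycle E'"
    "\<And>v. net E' w' v = net E w v" "flow_cost \<alpha> E' w' \<le> flow_cost \<alpha> E w"
proof -
  have "\<exists>E' w'. E' \<subseteq> E \<and> (\<forall>e\<in>E'. 0 < w' e) \<and> \<not> has_cycle E' \<and>
      (\<forall>v. net E' w' v = net E w v) \<and> flow_cost \<alpha> E' w' \<le> flow_cost \<alpha> E w"
    using assms(3,4)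
  proof (induction E arbitrary: w rule: finite_psubset_induct)
    case (psubset E)
    \<comment> \<open>A flow with an edge of weight zero lives on a smaller edge set, where the
      induction hypothesis applies.\<close>
    have shrink: ?case if w1: "\<And>e. e \<in> E \<Longrightarrow> 0 \<le> w1 e" "e0 \<in> E" "w1 e0 = 0"
        "\<And>v. net E w1 v = net E w v" "flow_cost \<alpha> E w1 \<le> flow_cost \<alpha> E w" for w1 e0
    proof -
      have less: "E - {e0} \<subset> E" using w1(2) by blast
      have nonneg: "0 \<le> w1 e" if "e \<in> E - {e0}" for e using w1(1) that by blast
      have n: "net (E - {e0}) w1 v = net E w1 v" for v
        using psubset.hyps(1) w1(3) by (intro net_mono_neutral) auto
      have c: "flow_cost \<alpha> (E - {e0}) w1 = flow_cost \<alpha> E w1"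
        using psubset.hyps(1) w1(3) by (intro flow_cost_mono_neutral) auto
      obtain E' w' where E': "E' \<subseteq> E - {e0}" "\<forall>e\<in>E'. 0 < w' e" "\<not> has_cycle E'"
        "\<forall>v. net E' w' v = net (E - {e0}) w1 v" "flow_cost \<alpha> E' w' \<le> flow_cost \<alpha> (E - {e0}) w1"
        using psubset.IH [OF less, of w1] nonneg by metis
      have "flow_cost \<alpha> E' w' \<le> flow_cost \<alpha> E w" using E'(5) w1(5) c by linarith
      moreover have "\<forall>v. net E' w' v = net E w v" using E'(4) n w1(4) by simp
      ultimately show ?thesis using E'(1-3) by blast
    qed
    consider e where "e \<in> E" "w e = 0"
      | "\<And>e. e \<in> E \<Longrightarrow> 0 < w e" "\<not> has_cycle E"
      | "\<And>e. e \<in> E \<Longrightarrow> 0 < w e" "has_cycle E"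
      using psubset.prems by (metis order_le_less)
    then show ?case
    proof cases
      case 1
      then show ?thesis using shrink [of w] psubset.prems by blast
    next
      case 2
      then show ?thesis by blast
    next
      case 3
      note pos = 3(1)
      obtain s e where s: "e \<in> E" "0 < s e" "\<And>v. net E s v = 0"
        using obtain_circulation [OF psubset.hyps(1) 3(2)] by metis
      \<comment> \<open>The direction must be negative somewhere and have slope at most 0. If
        \<open>s\<close> fails this, then \<open>-s\<close> qualifies: it is negative at
        \<open>e\<close>, and either \<open>s\<close> is nonnegative on \<open>E\<close> or its
        slope is positive.\<close>
      obtain \<sigma> e' where \<sigma>: "\<And>v. net E \<sigma> v = 0" "e' \<in> E" "\<sigma> e' < 0" "cost_slope \<alpha> E w \<sigma> \<le> 0"
      proof (cases "(\<exists>e'\<in>E. s e' < 0) \<and> cost_slope \<alpha> E w s \<le> 0")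
        case True
        then show thesis using s(3) that [of s] by blast
      next
        case False
        have "cost_slope \<alpha> E w (\<lambda>e. - s e) \<le> 0"
        proof (cases "\<exists>e'\<in>E. s e' < 0")
          case True
          then show ?thesis using False by (simp add: cost_slope_uminus)
        next
          case False
          then show ?thesis using assms(1) by (intro cost_slope_nonpos) (auto simp: not_less)
        qed
        moreover have "net E (\<lambda>e. - s e) v = 0" for v
          using net_scale [of E "-1" s v] s(3) by simp
        ultimately show thesis using s(1,2) that [of "\<lambda>e. - s e" e] by simp
      qed
      obtain t e0 where t: "0 < t" "\<And>e. e \<in> E \<Longrightarrow> 0 \<le> w e + t * \<sigma> e" "e0 \<in> E" "w e0 + t * \<sigma> e0 = 0"
        using obtain_vanishing_step [where w = w and s = \<sigma>, OF psubset.hyps(1) pos \<sigma>(2,3)] by metis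
      have "flow_cost \<alpha> E (\<lambda>e. w e + t * \<sigma> e) \<le> flow_cost \<alpha> E w + t * cost_slope \<alpha> E w \<sigma>"
        using assms(1,2) pos t(2) by (intro flow_cost_perturb_le) auto
      moreover have "t * cost_slope \<alpha> E w \<sigma> \<le> 0"
        using t(1) \<sigma>(4) by (intro mult_nonneg_nonpos) auto
      ultimately have "flow_cost \<alpha> E (\<lambda>e. w e + t * \<sigma> e) \<le> flow_cost \<alpha> E w" by linarith
      then show ?thesis
        using t \<sigma>(1) by (intro shrink [of "\<lambda>e. w e + t * \<sigma> e" e0]) (auto simp: net_perturb)
    qed
  qed
  then show thesis using that by metis
qed

section \<open>Components\<close>

definition component :: "('a \<times> 'a) set \<Rightarrow> 'a \<Rightarrow> 'a set" where
  "component E x = {v. (x, v) \<in> linked E}"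

text \<open>Testing the tail suffices, since the head lies in the same component.\<close>

definition component_edges :: "('a \<times> 'a) set \<Rightarrow> 'a \<Rightarrow> ('a \<times> 'a) set" where
  "component_edges E x = {e \<in> E. fst e \<in> component E x}"

definition component_support :: "('a::euclidean_space \<times> 'a) set \<Rightarrow> 'a \<Rightarrow> 'a set" where
  "component_support E x =
     component E x \<union> (\<Union>e\<in>component_edges E x. closed_segment (fst e) (snd e))"

lemma self_in_component [simp]: "x \<in> component E x"
  by (simp add: component_def)

lemma component_edges_subset: "component_edges E x \<subseteq> E"
  by (auto simp: component_edges_def)

lemma edge_in_component:
  assumes "(u, v) \<in> E"
  shows "u \<in> component E x \<longleftrightarrow> v \<in> component E x"
  unfolding component_def mem_Collect_eq
proof
  have uv: "(u, v) \<in> linked E" using assms by (rule linked_edge)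
  show "(x, v) \<in> linked E" if "(x, u) \<in> linked E" using that uv by (rule linked_trans)
  show "(x, u) \<in> linked E" if "(x, v) \<in> linked E" using that linked_sym [OF uv] by (rule linked_trans)
qed

lemma component_subset:
  assumes "E \<subseteq> V \<times> V" "x \<in> V"
  shows "component E x \<subseteq> V"
proof
  fix v assume "v \<in> component E x"
  then have "(x, v) \<in> linked E" by (simp add: component_def)
  then show "v \<in> V" by (induction rule: rtrancl_induct) (use assms in auto)
qed

text \<open>An edge has both ends in the component or neither, so the edges left out do not touch
  it.\<close>

lemma net_component_edges:
  assumes "finite E"
  shows "net (component_edges E x) w v = (if v \<in> component E x then net E w v else 0)"
proof (cases "v \<in> component E x")
  case True
  have "net (component_edges E x) w v = net E w v"
    unfolding net_def
  proof (rule sum.mono_neutral_left [OF assms component_edges_subset], rule ballI)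
    fix e assume "e \<in> E - component_edges E x"
    then have "fst e \<notin> component E x" "snd e \<notin> component E x"
      using edge_in_component [of "fst e" "snd e" E x] by (auto simp: component_edges_def)
    then show "w e * (of_bool (fst e = v) - of_bool (snd e = v)) = 0" using True by auto
  qed
  then show ?thesis using True by simp
next
  case False
  have "net (component_edges E x) w v = 0"
    unfolding net_def
  proof (rule sum.neutral, rule ballI)
    fix e assume "e \<in> component_edges E x"
    then have "fst e \<in> component E x" "snd e \<in> component E x"
      using edge_in_component [of "fst e" "snd e" E x] by (auto simp: component_edges_def)
    then show "w e * (of_bool (fst e = v) - of_bool (snd e = v)) = 0" using False by auto
  qed
  then show ?thesis using False by simp
qed


section \<open>Optimal flows\<close>

text \<open>The source masses are not part of the data: they are recovered as \<open>net E w v + b v\<close> at the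
  points of \<open>P\<close>. Cycles are admitted, so that flows may be added and edges may be subdivided.\<close>

locale allocation_problem =
  fixes X P :: "'a::euclidean_space set" and \<alpha> :: real and b :: "'a \<Rightarrow> real"
  assumes convex_X: "convex X" and \<alpha>_nonneg: "0 \<le> \<alpha>" and \<alpha>_less_1: "\<alpha> < 1"
    and b_nonneg: "0 \<le> b v"
begin

definition feasible :: "('a \<times> 'a) set \<Rightarrow> ('a \<times> 'a \<Rightarrow> real) \<Rightarrow> bool" where
  "feasible E w \<longleftrightarrow> finite E \<and> E \<subseteq> X \<times> X \<and> (\<forall>e\<in>E. 0 \<le> w e) \<and>
     (\<forall>v. 0 \<le> net E w v + b v) \<and> (\<forall>v. v \<notin> P \<longrightarrow> net E w v + b v = 0)"

text \<open>Competitors may contain cycles, loops and zero weights. The flow itself has only edges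
  of positive weight and length, which makes the tangent bound strict when one of them
  vanishes.\<close>

definition optimal_flow :: "('a \<times> 'a) set \<Rightarrow> ('a \<times> 'a \<Rightarrow> real) \<Rightarrow> bool" where
  "optimal_flow E w \<longleftrightarrow> feasible E w \<and> (\<forall>e\<in>E. 0 < w e \<and> fst e \<noteq> snd e) \<and>
     (\<forall>E' w'. feasible E' w' \<longrightarrow> flow_cost \<alpha> E w \<le> flow_cost \<alpha> E' w')"

section \<open>Perturbations of an optimal flow\<close>

lemma optimal_flowD:
  assumes "optimal_flow E w"
  shows "feasible E w" "finite E" "E \<subseteq> X \<times> X" "e \<in> E \<Longrightarrow> 0 < w e" "e \<in> E \<Longrightarrow> fst e \<noteq> snd e"
    "feasible E' w' \<Longrightarrow> flow_cost \<alpha> E w \<le> flow_cost \<alpha> E' w'"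
    "0 \<le> net E w v + b v" "v \<notin> P \<Longrightarrow> net E w v + b v = 0"
  using assms by (auto simp: optimal_flow_def feasible_def)

text \<open>The source masses change only where \<open>net E s\<close> is nonzero, so feasibility
  has to be checked only there.\<close>

lemma optimal_flow_perturb_le:
  assumes "optimal_flow E w" "\<And>e. e \<in> E \<Longrightarrow> 0 \<le> w e + t * s e"
    and "\<And>v. net E s v \<noteq> 0 \<Longrightarrow> v \<in> P \<and> 0 \<le> net E (\<lambda>e. w e + t * s e) v + b v"
  shows "flow_cost \<alpha> E w \<le> flow_cost \<alpha> E (\<lambda>e. w e + t * s e)"
proof (rule optimal_flowD(6) [OF assms(1)])
  note opt = optimal_flowD [OF assms(1)]
  have same: "net E (\<lambda>e. w e + t * s e) v = net E w v" if "net E s v = 0" for v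
    using that by (simp add: net_perturb)
  show "feasible E (\<lambda>e. w e + t * s e)"
    unfolding feasible_def
  proof (intro conjI allI impI)
    show "finite E" "E \<subseteq> X \<times> X" "\<forall>e\<in>E. 0 \<le> w e + t * s e"
      using opt(2,3) assms(2) by auto
    show "0 \<le> net E (\<lambda>e. w e + t * s e) v + b v" for v
      by (cases "net E s v = 0") (use same opt(7) assms(3) in auto)
    show "net E (\<lambda>e. w e + t * s e) v + b v = 0" if "v \<notin> P" for v
      using same opt(8) assms(3) that by metis
  qed
qed

text \<open>Push along \<open>s\<close> until an edge vanishes. The tangent bound is strict on that
  edge and the slope is not positive, so the cost would drop below the minimum.\<close>

lemma no_downhill_direction:
  assumes "optimal_flow E w" "e0 \<in> E" "s e0 < 0" "cost_slope \<alpha> E w s \<le> 0"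
    and "\<And>t v. 0 < t \<Longrightarrow> (\<And>e. e \<in> E \<Longrightarrow> 0 \<le> w e + t * s e) \<Longrightarrow> net E s v \<noteq> 0 \<Longrightarrow>
      v \<in> P \<and> 0 \<le> net E (\<lambda>e. w e + t * s e) v + b v"
  shows False
proof -
  note opt = optimal_flowD [OF assms(1)]
  obtain t e where t: "0 < t" "\<And>e. e \<in> E \<Longrightarrow> 0 \<le> w e + t * s e" "e \<in> E" "w e + t * s e = 0"
    using obtain_vanishing_step [where w = w and s = s, OF opt(2,4) assms(2,3)] by metis
  have "flow_cost \<alpha> E (\<lambda>e. w e + t * s e) < flow_cost \<alpha> E w + t * cost_slope \<alpha> E w s"
    using \<alpha>_nonneg \<alpha>_less_1 opt(2,4,5) t(2-4) by (intro flow_cost_perturb_less [of _ _ w t s e]) auto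
  moreover have "t * cost_slope \<alpha> E w s \<le> 0"
    using t(1) assms(4) by (intro mult_nonneg_nonpos) auto
  moreover have "flow_cost \<alpha> E w \<le> flow_cost \<alpha> E (\<lambda>e. w e + t * s e)"
    using t(1,2) assms(5) by (intro optimal_flow_perturb_le [OF assms(1)]) auto
  ultimately show False by linarith
qed

text \<open>By concavity, an interior point of a feasible segment that ends where some edge vanishes is
  not a minimum: either that end or a small step in the opposite direction is cheaper.\<close>

lemma no_two_sided_direction:
  assumes "optimal_flow E w" "e0 \<in> E" "s e0 < 0"
    and "\<And>t v. (\<And>e. e \<in> E \<Longrightarrow> 0 \<le> w e + t * s e) \<Longrightarrow> net E s v \<noteq> 0 \<Longrightarrow>
      v \<in> P \<and> 0 \<le> net E (\<lambda>e. w e + t * s e) v + b v"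
  shows False
proof (cases "cost_slope \<alpha> E w s \<le> 0")
  case True
  then show False using assms by (intro no_downhill_direction [of E w e0 s]) auto
next
  case False
  note opt = optimal_flowD [OF assms(1)]
  obtain t where t: "0 < t" "\<And>e. e \<in> E \<Longrightarrow> 0 \<le> w e + t * (- s e)"
    using obtain_small_step [where w = w and s = "\<lambda>e. - s e", OF opt(2,4)] by metis
  then have t': "\<And>e. e \<in> E \<Longrightarrow> 0 \<le> w e + (- t) * s e" by simp
  have "flow_cost \<alpha> E (\<lambda>e. w e + (- t) * s e) \<le> flow_cost \<alpha> E w + (- t) * cost_slope \<alpha> E w s"
    using \<alpha>_nonneg \<alpha>_less_1 opt(4) t' by (intro flow_cost_perturb_le) auto
  moreover have "(- t) * cost_slope \<alpha> E w s < 0"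
    using t(1) False by simp
  moreover have "flow_cost \<alpha> E w \<le> flow_cost \<alpha> E (\<lambda>e. w e + (- t) * s e)"
    using t' assms(4) [of "- t"] by (intro optimal_flow_perturb_le [OF assms(1)]) auto
  ultimately show False by linarith
qed

text \<open>Lowering the flow round a directed cycle changes no net outflow and raises no weight, so
  it would be a downhill direction.\<close>

lemma optimal_flow_acyclic:
  assumes "optimal_flow E w"
  shows "acyclic E"
proof (rule acyclicI, rule allI, rule notI)
  fix u assume "(u, u) \<in> E\<^sup>+"
  then obtain z where z: "(u, z) \<in> E" "(z, u) \<in> E\<^sup>*" by (meson tranclD)
  note opt = optimal_flowD [OF assms]
  obtain s where s: "\<And>e. 0 \<le> s e" "\<And>v. net E s v = of_bool (z = v) - of_bool (u = v)"
    using obtain_directed_unit_flow [OF opt(2) z(2)] by metis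
  \<comment> \<open>Minus one unit round the cycle: the return path from \<open>z\<close> to
    \<open>u\<close> together with the edge \<open>(u, z)\<close>.\<close>
  define c where "c e = (-1) * (s e + of_bool (e = (u, z)))" for e
  have "net E c v = 0" for v
    unfolding c_def net_scale net_add using s(2) net_of_bool [OF opt(2) z(1)] by simp
  moreover have "c e \<le> 0" for e using s(1) [of e] by (auto simp: c_def of_bool_def)
  moreover have "c (u, z) < 0" using s(1) [of "(u, z)"] by (simp add: c_def add_nonneg_pos)
  ultimately show False
    using no_downhill_direction [OF assms z(1), of c] cost_slope_nonpos [OF \<alpha>_nonneg] by blast
qed

text \<open>Go upstream as far as possible, which ends because \<open>E\<close> is finite and
  acyclic. The point reached has outgoing edges only, so its net outflow is positive and it carries
  source mass.\<close>

lemma obtain_root: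
  assumes "optimal_flow E w" "(u, v) \<in> E"
  obtains r where "r \<in> P" "(r, u) \<in> E\<^sup>*" "\<And>z. (z, r) \<notin> E"
proof -
  note opt = optimal_flowD [OF assms(1)]
  have "wf E" using opt(2) optimal_flow_acyclic [OF assms(1)] by (rule finite_acyclic_wf)
  then obtain r where r: "(r, u) \<in> E\<^sup>*" "\<And>z. (z, r) \<in> E \<Longrightarrow> (z, u) \<notin> E\<^sup>*"
    using wfE_min [of E u "{r. (r, u) \<in> E\<^sup>*}"] by auto
  then have root: "(z, r) \<notin> E" for z by (meson converse_rtrancl_into_rtrancl)
  have "(r, v) \<in> E\<^sup>+" using r(1) assms(2) by (rule rtrancl_into_trancl1)
  then obtain z where "(r, z) \<in> E" by (meson tranclD)
  then have "0 < net E w r" using root opt(2,4) by (intro net_pos_root) auto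
  then have "r \<in> P" using opt(8) [of r] b_nonneg [of r] by fastforce
  then show thesis using r(1) root that by blast
qed

text \<open>Flow that reaches \<open>x\<close> from a root \<open>r\<close> could start at
  \<open>x\<close> instead: source mass moves from \<open>r\<close> to \<open>x\<close>, and the
  weights on the way only decrease.\<close>

lemma no_edge_into_source:
  assumes "optimal_flow E w" "x \<in> P"
  shows "(u, x) \<notin> E"
proof
  assume u: "(u, x) \<in> E"
  note opt = optimal_flowD [OF assms(1)]
  obtain r where r: "r \<in> P" "(r, u) \<in> E\<^sup>*" "\<And>z. (z, r) \<notin> E"
    using obtain_root [OF assms(1) u] by blast
  have "r \<noteq> x" using r(3) u by blast
  have "(r, x) \<in> E\<^sup>*" using r(2) u by (rule rtrancl_into_rtrancl)
  then obtain s where s: "\<And>e. 0 \<le> s e" "\<And>v. net E s v = of_bool (r = v) - of_bool (x = v)"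
    using obtain_directed_unit_flow [OF opt(2)] by metis
  have "0 < net E s r" using s(2) \<open>r \<noteq> x\<close> by simp
  then obtain e where e: "e \<in> E" "0 < s e" using net_pos_imp_pos_edge r(3) by metis
  have net: "net E (\<lambda>e. - s e) v = of_bool (x = v) - of_bool (r = v)" for v
    using net_scale [of E "-1" s v] s(2) by simp
  show False
  proof (rule no_downhill_direction [OF assms(1) e(1), of "\<lambda>e. - s e"])
    show "- s e < 0" using e(2) by simp
    show "cost_slope \<alpha> E w (\<lambda>e. - s e) \<le> 0" using s(1) \<alpha>_nonneg by (intro cost_slope_nonpos) auto
    fix t v
    assume t: "0 < t" "\<And>e. e \<in> E \<Longrightarrow> 0 \<le> w e + t * - s e" and "net E (\<lambda>e. - s e) v \<noteq> 0"
    then have "v = r \<or> v = x" by (auto simp: net)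
    then show "v \<in> P \<and> 0 \<le> net E (\<lambda>e. w e + t * - s e) v + b v"
    proof
      \<comment> \<open>No edge enters \<open>r\<close>, so nonnegative weights keep the mass left
        at \<open>r\<close> nonnegative.\<close>
      assume "v = r"
      then show ?thesis using net_nonneg_root [of E _ r] t(2) r(1,3) b_nonneg [of r] by simp
    next
      assume "v = x"
      then show ?thesis using opt(7) [of x] t(1) assms(2) \<open>r \<noteq> x\<close> by (simp only: net_perturb net) simp
    qed
  qed
qed

text \<open>Mass could be shifted between \<open>x\<close> and \<open>x'\<close> along a path
  joining them. No edge enters either point, so nonnegative weights alone keep both masses
  nonnegative, whatever the sign of \<open>t\<close>, and the direction is two-sided.\<close>

lemma sources_not_linked:
  assumes "optimal_flow E w" "x \<in> P" "x' \<in> P" "x \<noteq> x'"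
  shows "(x, x') \<notin> linked E"
proof
  assume "(x, x') \<in> linked E"
  note opt = optimal_flowD [OF assms(1)]
  obtain s where s: "\<And>v. net E s v = of_bool (x = v) - of_bool (x' = v)"
    using obtain_unit_flow [OF opt(2) \<open>(x, x') \<in> linked E\<close>] by metis
  have root: "\<And>u. (u, x) \<notin> E" "\<And>u. (u, x') \<notin> E"
    using no_edge_into_source [OF assms(1)] assms(2,3) by blast+
  have "0 < net E s x" using s assms(4) by simp
  then obtain e where e: "e \<in> E" "0 < s e" using net_pos_imp_pos_edge root(1) by metis
  have net: "net E (\<lambda>e. - s e) v = of_bool (x' = v) - of_bool (x = v)" for v
    using net_scale [of E "-1" s v] s by simp
  show False
  proof (rule no_two_sided_direction [OF assms(1) e(1), of "\<lambda>e. - s e"])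
    show "- s e < 0" using e(2) by simp
    fix t v
    assume t: "\<And>e. e \<in> E \<Longrightarrow> 0 \<le> w e + t * - s e" and "net E (\<lambda>e. - s e) v \<noteq> 0"
    then have v: "v = x \<or> v = x'" by (auto simp: net)
    then have "0 \<le> net E (\<lambda>e. w e + t * - s e) v"
      using t root by (intro net_nonneg_root) auto
    then show "v \<in> P \<and> 0 \<le> net E (\<lambda>e. w e + t * - s e) v + b v"
      using v assms(2,3) b_nonneg [of v] by auto
  qed
qed


text \<open>Replacing \<open>E1\<close> by \<open>F\<close> inside \<open>E\<close> gives a feasible
  flow. By subadditivity it costs at most the sum of its two parts, so a cheaper \<open>F\<close>
  would contradict optimality.\<close>

lemma optimal_flow_subset_le:
  assumes "optimal_flow E w" "E1 \<subseteq> E" "finite F" "F \<subseteq> X \<times> X" "\<And>e. e \<in> F \<Longrightarrow> 0 \<le> w' e"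
    and "\<And>v. net F w' v = net E1 w v"
  shows "flow_cost \<alpha> E1 w \<le> flow_cost \<alpha> F w'"
proof -
  note opt = optimal_flowD [OF assms(1)]
  define H where "H = F \<union> (E - E1)"
  \<comment> \<open>\<open>F\<close> may share edges with \<open>E - E1\<close>; both weights are
    extended by zero to \<open>H\<close> and added there.\<close>
  define u where "u e = (if e \<in> F then w' e else 0)" for e
  define r where "r e = (if e \<in> E - E1 then w e else 0)" for e
  have fin: "finite H" "finite E1" "finite (E - E1)"
    using opt(2) assms(2,3) by (auto simp: H_def intro: finite_subset)
  have E: "E = E1 \<union> (E - E1)" using assms(2) by blast
  have H_nonneg: "0 \<le> u e" "0 \<le> r e" for e
    using assms(5) opt(4) by (auto simp: u_def r_def less_imp_le)
  have "net H u v = net F w' v" for v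
    using net_mono_neutral [of H F u v] net_cong [of F u w'] fin by (auto simp: H_def u_def)
  moreover have "net H r v = net (E - E1) w v" for v
  proof -
    have "net (E - E1) r v = net H r v" using fin(1) by (intro net_mono_neutral) (auto simp: H_def r_def)
    moreover have "net (E - E1) r v = net (E - E1) w v" by (intro net_cong) (auto simp: r_def)
    ultimately show ?thesis by simp
  qed
  moreover have "net E w v = net E1 w v + net (E - E1) w v" for v
    using net_union_disjoint [of E1 "E - E1" w v] fin E by simp
  ultimately have net_H: "net H (\<lambda>e. u e + r e) v = net E w v" for v
    using assms(6) by (simp add: net_add)
  have "H \<subseteq> X \<times> X" using assms(4) opt(3) by (auto simp: H_def)
  then have "feasible H (\<lambda>e. u e + r e)"
    using opt(7,8) fin(1) H_nonneg by (simp add: feasible_def net_H)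
  then have "flow_cost \<alpha> E w \<le> flow_cost \<alpha> H (\<lambda>e. u e + r e)"
    by (rule opt(6))
  also have "\<dots> \<le> flow_cost \<alpha> H u + flow_cost \<alpha> H r"
    using H_nonneg \<alpha>_less_1 by (intro flow_cost_add_le) auto
  also have "flow_cost \<alpha> H u = flow_cost \<alpha> F w'"
    using flow_cost_mono_neutral [of H F u] flow_cost_cong [of F u w'] fin by (auto simp: H_def u_def)
  also have "flow_cost \<alpha> H r = flow_cost \<alpha> (E - E1) w"
  proof -
    have "flow_cost \<alpha> (E - E1) r = flow_cost \<alpha> H r"
      using fin(1) by (intro flow_cost_mono_neutral) (auto simp: H_def r_def)
    moreover have "flow_cost \<alpha> (E - E1) r = flow_cost \<alpha> (E - E1) w"
      by (intro flow_cost_cong) (auto simp: r_def)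
    ultimately show ?thesis by simp
  qed
  finally show ?thesis
    using flow_cost_union_disjoint [of E1 "E - E1" \<alpha> w] fin E by simp
qed

section \<open>Disjointness of the components\<close>

text \<open>Edges may cross away from the vertices; subdividing at a crossing keeps the flow optimal and
  makes the crossing visible to \<open>linked\<close>.\<close>

lemma obtain_subdivision:
  assumes "optimal_flow E w" "e \<in> E" "p \<in> closed_segment (fst e) (snd e)"
  obtains E' w' where "optimal_flow E' w'" "linked E \<subseteq> linked E'" "(fst e, p) \<in> linked E'" "E - {e} \<subseteq> E'"
proof (cases "(fst e, p) \<in> linked E")
  case True
  then show thesis using that [of E w] assms(1) by blast
next
  case False
  note opt = optimal_flowD [OF assms(1)]
  define q where "q = fst e"
  define z where "z = snd e"
  have e: "e = (q, z)" "(q, z) \<in> E" using assms(2) by (auto simp: q_def z_def)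
  have "(q, p) \<notin> linked E" using False by (simp add: q_def)
  moreover from this have "(z, p) \<notin> linked E" using e(2) by (meson linked_edge linked_trans)
  \<comment> \<open>As \<open>p\<close> is not linked to the ends of \<open>e\<close>, the two
    halves are nondegenerate and not yet edges of \<open>E\<close>, so no weights have to be
    merged.\<close>
  ultimately have new: "(q, p) \<notin> E" "(p, z) \<notin> E" "p \<noteq> q" "p \<noteq> z"
    using linked_edge linked_sym by (metis, metis, auto)
  have p: "p \<in> closed_segment q z" using assms(3) by (simp add: q_def z_def)
  have "q \<in> X" "z \<in> X" using e(2) opt(3) by auto
  then have "p \<in> X" using p convex_X closed_segment_subset by blast
  define R where "R = E - {e}"
  define E' where "E' = R \<union> {(q, p), (p, z)}"
  define w' where "w' = w((q, p) := w e, (p, z) := w e)"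
  have R: "finite R" "(q, p) \<notin> R" "(p, z) \<notin> R" "E = R \<union> {(q, z)}" "(q, z) \<notin> R"
    using opt(2) new e by (auto simp: R_def)
  have w'_R: "w' f = w f" if "f \<in> R" for f using that R(2,3) by (auto simp: w'_def)
  have w'_new: "w' (q, p) = w e" "w' (p, z) = w e" using new by (auto simp: w'_def)
  have "net {(q, p), (p, z)} w' v = net {(q, z)} w v" for v
    using new e by (simp add: net_def w'_new flip: distrib_left)
  then have net': "net E' w' v = net E w v" for v
    using net_union_disjoint [of R "{(q, p), (p, z)}" w' v] net_union_disjoint [of R "{(q, z)}" w v]
      net_cong [of R w' w v] R w'_R by (simp add: E'_def)
  have "flow_cost \<alpha> {(q, p), (p, z)} w' = flow_cost \<alpha> {(q, z)} w"
    using new e between [of q z p] p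
    by (simp add: flow_cost_def w'_new between_mem_segment flip: distrib_left)
  then have cost': "flow_cost \<alpha> E' w' = flow_cost \<alpha> E w"
    using flow_cost_union_disjoint [of R "{(q, p), (p, z)}" \<alpha> w'] R w'_R
      flow_cost_union_disjoint [of R "{(q, z)}" \<alpha> w] flow_cost_cong [of R w' w \<alpha>]
    by (simp add: E'_def)
  have pos: "0 < w' f \<and> fst f \<noteq> snd f" if "f \<in> E'" for f
    using that opt(4,5) [OF assms(2)] opt(4,5) [of f] w'_R [of f] w'_new new by (auto simp: E'_def R_def)
  have "E' \<subseteq> X \<times> X" using opt(3) \<open>q \<in> X\<close> \<open>z \<in> X\<close> \<open>p \<in> X\<close> by (auto simp: E'_def R_def)
  moreover have "finite E'" using R(1) by (simp add: E'_def)
  ultimately have "feasible E' w'"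
    using opt(7,8) pos by (simp add: feasible_def net' less_imp_le)
  then have "optimal_flow E' w'"
    using pos opt(6) by (simp add: optimal_flow_def cost')
  moreover have "linked E \<subseteq> linked E'"
  proof (rule rtrancl_subset_rtrancl, rule subrelI)
    have qz: "(q, z) \<in> linked E'"
      by (rule linked_trans [of q p]) (auto simp: E'_def intro!: linked_edge)
    fix a c assume "(a, c) \<in> E \<union> E\<inverse>"
    then consider "(a, c) \<in> R" | "(c, a) \<in> R" | "(a, c) = (q, z)" | "(c, a) = (q, z)"
      using R(4) by auto
    then show "(a, c) \<in> linked E'"
    proof cases
      case 4
      then show ?thesis using linked_sym [OF qz] by simp
    qed (use qz in \<open>auto simp: E'_def intro: linked_edge\<close>)
  qed
  moreover have "(fst e, p) \<in> linked E'" by (auto simp: E'_def q_def intro!: linked_edge)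
  moreover have "E - {e} \<subseteq> E'" by (auto simp: E'_def R_def)
  ultimately show thesis by (rule that)
qed

lemma components_disjoint:
  assumes "optimal_flow E w" "x \<in> P" "x' \<in> P" "x \<noteq> x'"
  shows "component E x \<inter> component E x' = {}"
proof (rule ccontr)
  assume "component E x \<inter> component E x' \<noteq> {}"
  then obtain v where v: "(x, v) \<in> linked E" "(x', v) \<in> linked E" by (auto simp: component_def)
  show False using sources_not_linked [OF assms] linked_trans [OF v(1) linked_sym [OF v(2)]] by simp
qed

text \<open>At a common point \<open>p\<close>, subdividing an edge of each component where needed
  gives an optimal flow in which \<open>x\<close> and \<open>x'\<close> are linked through
  \<open>p\<close>.\<close>

lemma component_supports_disjoint:
  assumes "optimal_flow E w" "x \<in> P" "x' \<in> P" "x \<noteq> x'"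
  shows "component_support E x \<inter> component_support E x' = {}"
proof (rule ccontr)
  assume "component_support E x \<inter> component_support E x' \<noteq> {}"
  then obtain p where p: "p \<in> component_support E x" "p \<in> component_support E x'" by blast
  have split: "(y, p) \<in> linked E \<or>
      (\<exists>e\<in>E. (y, fst e) \<in> linked E \<and> p \<in> closed_segment (fst e) (snd e))"
    if "p \<in> component_support E y" for y
    using that unfolding component_support_def component_def component_edges_def by blast
  obtain E' w' where E': "optimal_flow E' w'" "linked E \<subseteq> linked E'" "(x, p) \<in> linked E'"
    "{f \<in> E. (x', fst f) \<in> linked E} \<subseteq> E'"
  proof (cases "(x, p) \<in> linked E")
    case True
    then show thesis using that [of E w] assms(1) by blast
  next
    case False
    then obtain e where e: "e \<in> E" "(x, fst e) \<in> linked E" "p \<in> closed_segment (fst e) (snd e)"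
      using split [OF p(1)] by blast
    obtain E' w' where "optimal_flow E' w'" "linked E \<subseteq> linked E'" "(fst e, p) \<in> linked E'" "E - {e} \<subseteq> E'"
      using obtain_subdivision [OF assms(1) e(1,3)] .
    \<comment> \<open>The subdivided edge is outside the component of \<open>x'\<close>, so that
      component keeps all its edges for the second subdivision.\<close>
    moreover have "(x', fst e) \<notin> linked E"
      using e(2) sources_not_linked [OF assms] by (meson linked_sym linked_trans)
    ultimately show thesis using e(2) by (intro that [of E' w']) (auto intro: linked_trans)
  qed
  obtain E'' w'' where E'': "optimal_flow E'' w''" "linked E' \<subseteq> linked E''" "(x', p) \<in> linked E''"
  proof (cases "(x', p) \<in> linked E'")
    case True
    then show thesis using that [of E' w'] E'(1) by blast
  next
    case False
    then obtain e where e: "e \<in> E" "(x', fst e) \<in> linked E" "p \<in> closed_segment (fst e) (snd e)"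
      using split [OF p(2)] E'(2) by blast
    then have "e \<in> E'" using E'(4) by blast
    obtain E'' w'' where "optimal_flow E'' w''" "linked E' \<subseteq> linked E''" "(fst e, p) \<in> linked E''"
      using obtain_subdivision [OF E'(1) \<open>e \<in> E'\<close> e(3)] .
    moreover have "(x', fst e) \<in> linked E'" using e(2) E'(2) by blast
    ultimately show thesis by (intro that [of E'' w'']) (auto intro: linked_trans)
  qed
  have "(x, x') \<in> linked E''"
    using subsetD [OF E''(2) E'(3)] linked_sym [OF E''(3)] by (rule linked_trans)
  then show False using sources_not_linked [OF E''(1) assms(2-4)] by blast
qed

section \<open>The flow carried by the component of a source\<close>

lemma edge_in_source_component:
  assumes "optimal_flow E w" "e \<in> E"
  obtains x where "x \<in> P" "e \<in> component_edges E x"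
proof -
  obtain r where "r \<in> P" "(r, fst e) \<in> E\<^sup>*"
    using obtain_root [OF assms(1), of "fst e" "snd e"] assms(2) by auto
  then show thesis
    using that assms(2) by (auto simp: component_edges_def component_def intro: rtrancl_subset_linked)
qed

text \<open>Outside \<open>P\<close> a positive demand makes the net outflow negative, so some edge
  enters \<open>v\<close>, and the component of that edge contains \<open>v\<close>.\<close>

lemma target_in_source_component:
  assumes "optimal_flow E w" "0 < b v"
  obtains x where "x \<in> P" "v \<in> component E x"
proof (cases "v \<in> P")
  case True
  then show thesis using that by simp
next
  case False
  have "\<exists>u. (u, v) \<in> E"
  proof (rule ccontr)
    assume "\<nexists>u. (u, v) \<in> E"
    then have "0 \<le> net E w v"
      using optimal_flowD(4) [OF assms(1)] by (intro net_nonneg_root) (auto simp: less_imp_le)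
    then show False using optimal_flowD(8) [OF assms(1) False] assms(2) by linarith
  qed
  then obtain u where "(u, v) \<in> E" by blast
  then show thesis
    using edge_in_source_component [OF assms(1)] edge_in_component [of u v E] that
    by (metis (no_types, lifting) component_edges_def fst_conv mem_Collect_eq)
qed

text \<open>Net outflows over the component sum to zero. It contains no other point of
  \<open>P\<close>, so the net outflow at each other point is minus the demand, and \<open>x\<close>
  has to supply the demand of the whole component.\<close>

lemma net_component_edges_source:
  assumes "optimal_flow E w" "x \<in> P" "finite V" "E \<subseteq> V \<times> V" "x \<in> V"
  shows "net (component_edges E x) w v =
    (if v \<in> component E x then (if v = x then sum b (component E x) else 0) - b v else 0)"
proof -
  note opt = optimal_flowD [OF assms(1)]
  let ?C = "component E x"
  have fin: "finite ?C" using component_subset [OF assms(4,5)] assms(3) finite_subset by blast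
  have other: "net E w u = - b u" if "u \<in> ?C - {x}" for u
  proof -
    have "(x, u) \<in> linked E" "x \<noteq> u" using that by (auto simp: component_def)
    then have "u \<notin> P" using sources_not_linked [OF assms(1,2), of u] by blast
    then show ?thesis using opt(8) [of u] by simp
  qed
  have sub: "component_edges E x \<subseteq> ?C \<times> ?C"
    using edge_in_component [of _ _ E x] by (auto simp: component_edges_def)
  have "0 = (\<Sum>u\<in>?C. net (component_edges E x) w u)"
    using sum_net_eq_0 [OF fin sub] by simp
  also have "\<dots> = (\<Sum>u\<in>?C. net E w u)"
    using net_component_edges [OF opt(2)] by (intro sum.cong) auto
  also have "\<dots> = net E w x + (\<Sum>u\<in>?C - {x}. - b u)"
    using fin other by (simp add: sum.remove [of _ x])
  also have "\<dots> = net E w x + b x - sum b ?C"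
    using fin by (simp add: sum.remove [of ?C x b] sum_negf)
  finally show ?thesis
    using other [of v] net_component_edges [OF opt(2)] by auto
qed


end

section \<open>Transport paths as flows\<close>

lemma atom_mass_eq_0: "v \<notin> atom_points a \<Longrightarrow> atom_mass a {v} = 0"
  unfolding atom_mass_def atom_points_def by (intro sum.neutral) (auto simp: indicator_def)

lemma sum_atom_mass:
  assumes "finite V" "atom_points a \<subseteq> V"
  shows "(\<Sum>v\<in>V. atom_mass a {v}) = (\<Sum>i\<in>atom_index a. atom_weight a i)"
proof -
  have "(\<Sum>v\<in>V. atom_mass a {v}) =
      (\<Sum>i\<in>atom_index a. \<Sum>v\<in>V. atom_weight a i * indicator {v} (atom_point a i))"
    unfolding atom_mass_def by (rule sum.swap)
  also have "\<dots> = (\<Sum>i\<in>atom_index a. atom_weight a i)"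
  proof (rule sum.cong)
    fix i assume "i \<in> atom_index a"
    then have "atom_point a i \<in> V" using assms(2) by (auto simp: atom_points_def)
    then show "(\<Sum>v\<in>V. atom_weight a i * indicator {v} (atom_point a i)) = atom_weight a i"
      using assms(1) by (simp add: indicator_def if_distrib cong: if_cong)
  qed simp
  finally show ?thesis .
qed

lemma atom_mass_inj:
  assumes "inj_on p I" "finite I" "i \<in> I"
  shows "atom_mass (Atomic I m p) {p i} = m i"
proof -
  have "atom_mass (Atomic I m p) {p i} = (\<Sum>j\<in>I. if j = i then m i else 0)"
    unfolding atom_mass_def using assms by (intro sum.cong) (auto simp: indicator_def dest: inj_onD)
  then show ?thesis using assms by simp
qed

text \<open>Outside the vertex set both sides are 0, so the balance holds at every point.\<close>

lemma transport_paths_net: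
  assumes "G \<in> transport_paths X a c"
  shows "net (edges G) (weight G) v = atom_mass a {v} - atom_mass c {v}"
proof -
  have G: "finite (verts G)" "atom_points a \<union> atom_points c \<subseteq> verts G" "edges G \<subseteq> verts G \<times> verts G"
    "v \<in> verts G \<Longrightarrow> (\<Sum>e\<in>{e\<in>edges G. fst e = v}. weight G e) =
      (\<Sum>e\<in>{e\<in>edges G. snd e = v}. weight G e) + atom_mass a {v} - atom_mass c {v}"
    using assms by (auto simp: transport_paths_def)
  show ?thesis
  proof (cases "v \<in> verts G")
    case True
    have "finite (edges G)" using G(1,3) finite_subset by blast
    then show ?thesis using G(4) [OF True] by (simp add: net_eq_out_minus_in)
  next
    case False
    then have "net (edges G) (weight G) v = 0"
      unfolding net_def using G(3) by (intro sum.neutral) auto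
    moreover have "atom_mass a {v} = 0" "atom_mass c {v} = 0"
      using False G(2) by (auto intro!: atom_mass_eq_0)
    ultimately show ?thesis by simp
  qed
qed

lemma transport_pathsD:
  assumes "G \<in> transport_paths X a c"
  shows "finite (verts G)" "finite (edges G)" "edges G \<subseteq> verts G \<times> verts G" "edges G \<subseteq> X \<times> X"
    "e \<in> edges G \<Longrightarrow> 0 < weight G e" "\<not> has_cycle (edges G)" "verts G \<subseteq> X"
    "atom_points a \<union> atom_points c \<subseteq> verts G"
proof -
  show G: "finite (verts G)" "edges G \<subseteq> verts G \<times> verts G" "e \<in> edges G \<Longrightarrow> 0 < weight G e"
    "\<not> has_cycle (edges G)" "verts G \<subseteq> X" "atom_points a \<union> atom_points c \<subseteq> verts G"
    using assms by (auto simp: transport_paths_def)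
  show "finite (edges G)" using G(1,2) finite_subset by blast
  show "edges G \<subseteq> X \<times> X" using G(2,5) by blast
qed

lemma transport_pathsI:
  assumes "finite V" "V \<subseteq> X" "atom_points a \<union> atom_points c \<subseteq> V" "E \<subseteq> V \<times> V"
    "\<And>e. e \<in> E \<Longrightarrow> 0 < w e" "\<not> has_cycle E"
    "\<And>v. v \<in> V \<Longrightarrow> net E w v = atom_mass a {v} - atom_mass c {v}"
  shows "\<lparr>verts = V, edges = E, weight = w\<rparr> \<in> transport_paths X a c"
proof -
  have "finite E" using assms(1,4) finite_subset by blast
  then show ?thesis
    using assms by (auto simp: transport_paths_def net_eq_out_minus_in algebra_simps)
qed

text \<open>A cycle of length one, closed by \<open>Suc 0 mod 1 = 0\<close>.\<close>

lemma loop_imp_has_cycle: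
  assumes "e \<in> E" "fst e = snd e"
  shows "has_cycle E"
  unfolding has_cycle_def using assms by (intro exI [of _ "[fst e]"] exI [of _ "[e]"]) auto

text \<open>A feasible competitor is made acyclic at no extra cost and then read as an allocation
  path, to which the minimality of \<open>G\<close> applies.\<close>

lemma optimal_allocation_path_imp_optimal_flow:
  fixes X :: "'a::euclidean_space set"
  assumes X: "convex X" "x ` {1..k} \<subseteq> X" "inj_on x {1..k}" "y ` {1..l} \<subseteq> X"
    and n: "\<forall>j\<in>{1..l}. 0 < n j" "(\<Sum>j=1..l. n j) = 1" and \<alpha>: "0 \<le> \<alpha>" "\<alpha> < 1"
    and G: "optimal_allocation_path X \<alpha> k x (Atomic {1..l} n y) G"
  shows "allocation_problem.optimal_flow X (x ` {1..k}) \<alpha> (\<lambda>v. atom_mass (Atomic {1..l} n y) {v})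
    (edges G) (weight G)"
proof -
  define c where "c = Atomic {1..l} n y"
  interpret allocation_problem X "x ` {1..k}" \<alpha> "\<lambda>v. atom_mass c {v}"
    using X(1) \<alpha> n(1) by unfold_locales (auto simp: c_def atom_mass_def less_imp_le intro!: sum_nonneg)
  have "G \<in> allocation_paths X k x c"
    and min: "\<And>H. H \<in> allocation_paths X k x c \<Longrightarrow> M_cost \<alpha> G \<le> M_cost \<alpha> H"
    using G by (auto simp: optimal_allocation_path_def is_arg_min_linorder c_def)
  then obtain m where m: "\<forall>i\<in>{1..k}. 0 \<le> m i" and path: "G \<in> transport_paths X (Atomic {1..k} m x) c"
    by (auto simp: allocation_paths_def)
  note G = transport_pathsD [OF path]
  have "0 \<le> atom_mass (Atomic {1..k} m x) {v}" for v
    using m by (auto simp: atom_mass_def intro!: sum_nonneg)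
  moreover have "atom_mass (Atomic {1..k} m x) {v} = 0" if "v \<notin> x ` {1..k}" for v
    using that by (intro atom_mass_eq_0) (simp add: atom_points_def)
  ultimately have feas: "feasible (edges G) (weight G)"
    unfolding feasible_def transport_paths_net [OF path] using G(2,4,5) by (simp add: less_imp_le)
  have "flow_cost \<alpha> (edges G) (weight G) \<le> flow_cost \<alpha> E w" if "feasible E w" for E w
  proof -
    have E: "finite E" "E \<subseteq> X \<times> X" "\<And>e. e \<in> E \<Longrightarrow> 0 \<le> w e"
      "\<And>v. 0 \<le> net E w v + atom_mass c {v}"
      "\<And>v. v \<notin> x ` {1..k} \<Longrightarrow> net E w v + atom_mass c {v} = 0"
      using that unfolding feasible_def by blast+
    obtain E' w' where E': "E' \<subseteq> E" "\<And>e. e \<in> E' \<Longrightarrow> 0 < w' e" "\<not> has_cycle E'"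
      "\<And>v. net E' w' v = net E w v" "flow_cost \<alpha> E' w' \<le> flow_cost \<alpha> E w"
      using obtain_acyclic_flow [where w = w, OF \<alpha> E(1,3)] by blast
    \<comment> \<open>The masses that the competitor draws from the points \<open>x i\<close>;
      feasibility makes them nonnegative.\<close>
    define m' where "m' i = net E w (x i) + atom_mass c {x i}" for i
    define V where "V = fst ` E' \<union> snd ` E' \<union> x ` {1..k} \<union> y ` {1..l}"
    have "finite E'" "E' \<subseteq> X \<times> X" using E'(1) E(1,2) finite_subset by blast+
    then have V: "finite V" "V \<subseteq> X" using X(2,4) by (auto simp: V_def)
    have points: "atom_points (Atomic {1..k} m' x) \<union> atom_points c \<subseteq> V"
      by (auto simp: V_def atom_points_def c_def)
    have E'_V: "E' \<subseteq> V \<times> V"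
      unfolding V_def by (force intro: rev_image_eqI)
    have bal: "net E' w' v = atom_mass (Atomic {1..k} m' x) {v} - atom_mass c {v}" for v
    proof (cases "v \<in> x ` {1..k}")
      case True
      then show ?thesis using atom_mass_inj [OF X(3)] by (auto simp: E'(4) m'_def)
    next
      case False
      then show ?thesis
        using E(5) [OF False] atom_mass_eq_0 [of v "Atomic {1..k} m' x"]
        by (simp add: E'(4) atom_points_def)
    qed
    have path': "\<lparr>verts = V, edges = E', weight = w'\<rparr> \<in> transport_paths X (Atomic {1..k} m' x) c"
      using V points E'_V E'(2,3) bal by (intro transport_pathsI) auto
    \<comment> \<open>Supply equals demand in total, so the masses \<open>m'\<close> sum to
      1.\<close>
    have "0 = (\<Sum>v\<in>V. net E' w' v)" using sum_net_eq_0 [OF V(1) E'_V] by simp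
    also have "\<dots> = (\<Sum>i=1..k. m' i) - (\<Sum>j=1..l. n j)"
      using sum_atom_mass [OF V(1), of c] sum_atom_mass [OF V(1), of "Atomic {1..k} m' x"] points
      by (simp add: bal sum_subtractf c_def)
    finally have "(\<Sum>i=1..k. m' i) = 1" using n(2) by simp
    then have "\<lparr>verts = V, edges = E', weight = w'\<rparr> \<in> allocation_paths X k x c"
      unfolding allocation_paths_def mem_Collect_eq
      using path' E(4) by (intro exI [of _ m'] conjI) (simp_all add: m'_def)
    then have "M_cost \<alpha> G \<le> flow_cost \<alpha> E' w'"
      using min [of "\<lparr>verts = V, edges = E', weight = w'\<rparr>"] by (simp add: M_cost_eq_flow_cost)
    then show ?thesis using E'(5) by (simp add: M_cost_eq_flow_cost)
  qed
  then show ?thesis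
    unfolding optimal_flow_def c_def [symmetric] using feas G(5,6) loop_imp_has_cycle by blast
qed

section \<open>Assembly of the decomposition from the components\<close>

theorem proposition3p2:
  fixes X :: "'a::euclidean_space set"
    and \<alpha> :: real and k l :: nat
    and x y :: "nat \<Rightarrow> 'a" and n :: "nat \<Rightarrow> real"
    and G :: "'a wgraph"
  assumes "compact X" and "convex X"
    and "x ` {1..k} \<subseteq> X" and "inj_on x {1..k}"
    and "y ` {1..l} \<subseteq> X"
    and "\<forall>j\<in>{1..l}. 0 < n j" and "(\<Sum>j=1..l. n j) = 1"
    and "0 \<le> \<alpha>" and "\<alpha> < 1"
    and "optimal_allocation_path X \<alpha> k x (Atomic {1..l} n y) G"
  shows "\<exists>S\<in>assignment_maps l k.
    E_cost X \<alpha> k x l n y S = M_cost \<alpha> G \<and>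
    (\<exists>Gs.
      (\<forall>i\<in>{1..k}.
        Gs i \<in> transport_paths X (part_source l n x S i) (part_target l n y S i) \<and>
        optimal_transport_path X \<alpha> (part_source l n x S i) (part_target l n y S i) (Gs i) \<and>
        M_cost \<alpha> (Gs i) = d_cost X \<alpha> (part_source l n x S i) (part_target l n y S i)) \<and>
      disjoint_family_on (\<lambda>i. graph_support (Gs i)) {1..k} \<and>
      chain_sum G {1..k} Gs \<and>
      M_cost \<alpha> G = (\<Sum>i=1..k. M_cost \<alpha> (Gs i)))"
proof -
  define c where "c = Atomic {1..l} n y"
  interpret allocation_problem X "x ` {1..k}" \<alpha> "\<lambda>v. atom_mass c {v}"
    using assms(2,6,8,9) by unfold_locales (auto simp: c_def atom_mass_def less_imp_le intro!: sum_nonneg)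
  define E where "E = edges G"
  define w where "w = weight G"
  have opt: "optimal_flow E w"
    using optimal_allocation_path_imp_optimal_flow [OF assms(2-10)] by (simp add: E_def w_def c_def)
  note optD = optimal_flowD [OF opt]
  obtain m where path: "G \<in> transport_paths X (Atomic {1..k} m x) c"
    using assms(10) by (auto simp: optimal_allocation_path_def is_arg_min_def allocation_paths_def c_def)
  note pathD = transport_pathsD [OF path, folded E_def w_def]
  have x_verts: "x i \<in> verts G" if "i \<in> {1..k}" for i
    using pathD(8) that by (auto simp: atom_points_def)

  define C where "C i = component E (x i)" for i
  define CE where "CE i = component_edges E (x i)" for i
  define Gs where "Gs i = \<lparr>verts = C i, edges = CE i, weight = w\<rparr>" for i
  have uniq: "i = i'" if "i \<in> {1..k}" "i' \<in> {1..k}" "v \<in> C i" "v \<in> C i'" for i i' v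
    using components_disjoint [OF opt, of "x i" "x i'"] that inj_onD [OF assms(4)]
    by (auto simp: C_def)
  \<comment> \<open>Several targets may coincide, but all masses are positive, so nothing
    cancels.\<close>
  have mass_pos: "0 < atom_mass c {y j}" if "j \<in> {1..l}" for j
  proof -
    have "0 < n j * indicator {y j} (y j)" using assms(6) that by simp
    also have "\<dots> \<le> atom_mass c {y j}"
      unfolding atom_mass_def c_def atomic.sel
      using assms(6) that by (intro member_le_sum [where f = "\<lambda>i. n i * indicator {y j} (y i)"])
        (auto simp: less_imp_le)
    finally show ?thesis .
  qed
  have "\<exists>i\<in>{1..k}. y j \<in> C i" if "j \<in> {1..l}" for j
    using target_in_source_component [OF opt mass_pos [OF that]] by (auto simp: C_def)
  then obtain S0 where S0: "\<And>j. j \<in> {1..l} \<Longrightarrow> S0 j \<in> {1..k} \<and> y j \<in> C (S0 j)" by metis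
  \<comment> \<open>\<open>S j\<close> is the index of the component containing \<open>y j\<close>;
    the restriction makes the map extensional.\<close>
  define S where "S = restrict S0 {1..l}"
  have S: "S \<in> assignment_maps l k" using S0 by (auto simp: S_def assignment_maps_def)
  have fibre: "fibre l S i = {j\<in>{1..l}. y j \<in> C i}" if "i \<in> {1..k}" for i
    using S0 uniq that by (auto simp: fibre_def S_def)

  have Gs_path: "Gs i \<in> transport_paths X (part_source l n x S i) (part_target l n y S i)"
    and Gs_min: "\<And>H. H \<in> transport_paths X (part_source l n x S i) (part_target l n y S i) \<Longrightarrow>
      M_cost \<alpha> (Gs i) \<le> M_cost \<alpha> H"
    if i: "i \<in> {1..k}" for i
  proof -
    let ?a = "part_source l n x S i" and ?b = "part_target l n y S i"
    have C: "C i \<subseteq> verts G"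
      unfolding C_def using pathD(3) x_verts [OF i] by (rule component_subset)
    then have finC: "finite (C i)" using pathD(1) finite_subset by blast
    have points: "atom_points ?a \<union> atom_points ?b \<subseteq> C i"
      using fibre [OF i] by (auto simp: part_source_def part_target_def atom_points_def C_def)
    \<comment> \<open>Every atom of \<open>c\<close> at a point of \<open>C i\<close> has its index
      in the fibre, so the target of the piece is \<open>c\<close> restricted to
      \<open>C i\<close>.\<close>
    have target: "atom_mass ?b {v} = (if v \<in> C i then atom_mass c {v} else 0)" for v
    proof (cases "v \<in> C i")
      case True
      then have "atom_mass ?b {v} = atom_mass c {v}"
        unfolding atom_mass_def part_target_def c_def atomic.sel fibre [OF i]
        by (intro sum.mono_neutral_left) (auto simp: indicator_def)
      then show ?thesis using True by simp
    next
      case False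
      then show ?thesis using points atom_mass_eq_0 [of v ?b] by auto
    qed
    have total: "(\<Sum>v\<in>C i. atom_mass c {v}) = (\<Sum>j\<in>fibre l S i. n j)"
      using sum_atom_mass [OF finC, of ?b] points target by (simp add: part_target_def)
    have source: "atom_mass ?a {v} = (if v = x i then \<Sum>j\<in>fibre l S i. n j else 0)" for v
      by (auto simp: atom_mass_def part_source_def indicator_def)
    have net_CE: "net (CE i) w v = atom_mass ?a {v} - atom_mass ?b {v}" for v
      using net_component_edges_source [OF opt _ pathD(1,3) x_verts [OF i], of v] i
        self_in_component [of "x i" E] by (auto simp: CE_def source target total simp flip: C_def)
    have CE: "CE i \<subseteq> E" by (auto simp: CE_def component_edges_def)
    have CE_C: "CE i \<subseteq> C i \<times> C i"
      using edge_in_component [of _ _ E "x i"] by (auto simp: CE_def C_def component_edges_def)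
    show "Gs i \<in> transport_paths X ?a ?b"
      unfolding Gs_def
      using finC C pathD(7) points CE_C CE pathD(5,6) has_cycle_mono [OF _ CE] net_CE
      by (intro transport_pathsI) auto
    show "M_cost \<alpha> (Gs i) \<le> M_cost \<alpha> H" if "H \<in> transport_paths X ?a ?b" for H
    proof -
      \<comment> \<open>\<open>H\<close> has the same net outflow as \<open>CE i\<close>, so
        substituting it for this piece cannot make \<open>G\<close> cheaper.\<close>
      have "flow_cost \<alpha> (CE i) w \<le> flow_cost \<alpha> (edges H) (weight H)"
        using transport_pathsD(2,4,5) [OF that] transport_paths_net [OF that] net_CE
        by (intro optimal_flow_subset_le [OF opt CE]) (auto simp: less_imp_le)
      then show ?thesis by (simp add: M_cost_eq_flow_cost Gs_def)
    qed
  qed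
  have Gs_d: "M_cost \<alpha> (Gs i) = d_cost X \<alpha> (part_source l n x S i) (part_target l n y S i)"
    if "i \<in> {1..k}" for i
    unfolding d_cost_def using Gs_path [OF that] Gs_min [OF that]
    by (intro cInf_eq_minimum [symmetric]) auto

  have E_Union: "E = (\<Union>i\<in>{1..k}. CE i)"
  proof
    show "E \<subseteq> (\<Union>i\<in>{1..k}. CE i)"
      using edge_in_source_component [OF opt] unfolding CE_def by blast
  qed (auto simp: CE_def component_edges_def)
  have CE_disjoint: "CE i \<inter> CE i' = {}" if "i \<in> {1..k}" "i' \<in> {1..k}" "i \<noteq> i'" for i i'
    using uniq that by (auto simp: CE_def C_def component_edges_def)
  \<comment> \<open>Cost and chain integral are both sums over edges, so this identity splits
    both.\<close>
  have sum_E: "sum f E = (\<Sum>i=1..k. sum f (CE i))" for f :: "'a \<times> 'a \<Rightarrow> real"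
  proof -
    have "\<forall>i\<in>{1..k}. finite (CE i)"
      using optD(2) by (auto simp: CE_def component_edges_def)
    then show ?thesis
      unfolding E_Union using CE_disjoint by (intro sum.UNION_disjoint) auto
  qed
  have M_sum: "M_cost \<alpha> G = (\<Sum>i=1..k. M_cost \<alpha> (Gs i))"
    unfolding M_cost_def Gs_def using sum_E by (simp flip: E_def w_def)
  have "chain_sum G {1..k} Gs"
    unfolding chain_sum_def chain_integral_def Gs_def using sum_E by (simp flip: E_def w_def)
  moreover have "disjoint_family_on (\<lambda>i. graph_support (Gs i)) {1..k}"
  proof -
    have "graph_support (Gs i) = component_support E (x i)" for i
      by (simp add: graph_support_def component_support_def Gs_def C_def CE_def)
    moreover have "x i \<noteq> x i'" if "i \<in> {1..k}" "i' \<in> {1..k}" "i \<noteq> i'" for i i'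
      using inj_on_contraD [OF assms(4)] that by blast
    ultimately show ?thesis
      using component_supports_disjoint [OF opt] unfolding disjoint_family_on_def by simp
  qed
  moreover have "E_cost X \<alpha> k x l n y S = M_cost \<alpha> G"
    unfolding E_cost_def M_sum using Gs_d by simp
  ultimately show ?thesis
    using S Gs_path Gs_min Gs_d M_sum unfolding optimal_transport_path_def is_arg_min_linorder
    by (intro bexI [of _ S] conjI exI [of _ Gs]) blast+
qed

end
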